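(* Let $R$ be a commutative reduced ring with unity. The following statements are equivalent. (a) $\mathrm{dt}(\mathbb{AG}(R))$ is finite. (b) $\mathrm{dt}_t(\mathbb{AG}(R))$ is finite. (c) $\mathrm{Min}(R)$ is finite.
   Context: For $S\subseteq R$, $\mathrm{Ann}(S)=\{x\in R: Sx=\{0\}\}$. $\mathbb{A}(R)^*$ is the set of non-zero ideals $I$ of $R$ with $\mathrm{Ann}(I)\neq\{0\}$; the annihilating-ideal graph $\mathbb{AG}(R)$ has vertex set $\mathbb{A}(R)^*$, distinct $I,J$ being adjacent iff $IJ=\{0\}$. $\mathrm{Min}(R)$ is the set of minimal prime ideals of $R$. For a graph $G$, a dominating set is a set $D$ of vertices such that every vertex is in $D$ or adjacent to some vertex of $D$; a total dominating set is a set $S$ of vertices such that every vertex is adjacent to some vertex of $S$; $\mathrm{dt}(G)$ and $\mathrm{dt}_t(G)$ are the minimum cardinalities (possibly infinite cardinals) of a dominating set and of a total dominating set, respectively. *)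

theory Defs
  imports "HOL-Algebra.Algebra" "Graph_Theory.Pair_Digraph"
begin

section \<open>Domination numbers of simple graphs\<close>

text \<open>
  A (possibly infinite) simple graph is a symmetric loopfree \<^typ>\<open>'v pair_pre_digraph\<close>,
  i.e. one satisfying \<^locale>\<open>pair_bidirected_digraph\<close>; the pair \<open>(u, v)\<close> is in \<^term>\<open>parcs G\<close> iff
  \<open>u\<close> and \<open>v\<close> are adjacent.
\<close>

definition dominating_set :: "'v pair_pre_digraph \<Rightarrow> 'v set \<Rightarrow> bool" where
  "dominating_set G D \<longleftrightarrow>
     D \<subseteq> pverts G \<and> (\<forall>v\<in>pverts G. v \<in> D \<or> (\<exists>u\<in>D. (v, u) \<in> parcs G))"

definition total_dominating_set :: "'v pair_pre_digraph \<Rightarrow> 'v set \<Rightarrow> bool" where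
  "total_dominating_set G S \<longleftrightarrow>
     S \<subseteq> pverts G \<and> (\<forall>v\<in>pverts G. \<exists>u\<in>S. (v, u) \<in> parcs G)"

text \<open>
  Cardinals are represented as in the library by well-order relations, \<open>card_of A\<close> being the
  cardinal of \<open>A\<close> and \<open>ordLeq3\<close> their order. The least cardinality is unspecified for the empty family.
\<close>

definition least_cardinality :: "'v set set \<Rightarrow> 'v rel" where
  "least_cardinality F = card_of (SOME D. D \<in> F \<and> (\<forall>D'\<in>F. ordLeq3 (card_of D) (card_of D')))"

lemma least_cardinality:
  assumes "F \<noteq> {}"
  shows "\<exists>D\<in>F. least_cardinality F = card_of D"
    and "\<forall>D\<in>F. ordLeq3 (least_cardinality F) (card_of D)"
proof -
  have "\<exists>r\<in>card_of ` F. \<forall>r'\<in>card_of ` F. ordLeq3 r r'"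
    using assms by (intro exists_minim_Card_order) (auto simp: card_of_Card_order)
  then have "\<exists>D. D \<in> F \<and> (\<forall>D'\<in>F. ordLeq3 (card_of D) (card_of D'))"
    by blast
  from someI_ex[OF this] show "\<exists>D\<in>F. least_cardinality F = card_of D"
    and "\<forall>D\<in>F. ordLeq3 (least_cardinality F) (card_of D)"
    unfolding least_cardinality_def by blast+
qed

definition dt :: "'v pair_pre_digraph \<Rightarrow> 'v rel" where
  "dt G = least_cardinality {D. dominating_set G D}"

definition dt_t :: "'v pair_pre_digraph \<Rightarrow> 'v rel" where
  "dt_t G = least_cardinality {S. total_dominating_set G S}"


section \<open>The annihilating-ideal graph\<close>

definition reduced_ring :: "('a, 'b) ring_scheme \<Rightarrow> bool" where
  "reduced_ring R \<longleftrightarrow>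
     (\<forall>x\<in>carrier R. \<forall>n::nat. x [^]\<^bsub>R\<^esub> n = \<zero>\<^bsub>R\<^esub> \<longrightarrow> x = \<zero>\<^bsub>R\<^esub>)"

definition Ann :: "('a, 'b) ring_scheme \<Rightarrow> 'a set \<Rightarrow> 'a set" where
  "Ann R S = {x \<in> carrier R. \<forall>s\<in>S. s \<otimes>\<^bsub>R\<^esub> x = \<zero>\<^bsub>R\<^esub>}"

definition annihilating_ideals :: "('a, 'b) ring_scheme \<Rightarrow> 'a set set" where
  "annihilating_ideals R = {I. ideal I R \<and> I \<noteq> {\<zero>\<^bsub>R\<^esub>} \<and> Ann R I \<noteq> {\<zero>\<^bsub>R\<^esub>}}"

definition AG :: "('a, 'b) ring_scheme \<Rightarrow> 'a set pair_pre_digraph" where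
  "AG R = \<lparr>pverts = annihilating_ideals R,
     parcs = {(I, J). I \<in> annihilating_ideals R \<and> J \<in> annihilating_ideals R \<and>
                      I \<noteq> J \<and> ideal_prod R I J = {\<zero>\<^bsub>R\<^esub>}}\<rparr>"

definition Min_primes :: "('a, 'b) ring_scheme \<Rightarrow> 'a set set" where
  "Min_primes R = {P. primeideal P R \<and> (\<forall>Q. primeideal Q R \<and> Q \<subseteq> P \<longrightarrow> Q = P)}"

lemma (in cring) AG_bidirected: "pair_bidirected_digraph (AG R)"
proof unfold_locales
  show "symmetric (with_proj (AG R))"
    unfolding symmetric_def with_proj_simps
    by (rule symI) (auto simp: AG_def annihilating_ideals_def ideal_prod_commute)
qed (auto simp: AG_def)

text \<open>
  Over a reduced ring no vertex \<open>I\<close> is isolated (it is adjacent to its annihilator), so that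
  \<^const>\<open>dt_t\<close> is a minimum over a nonempty family.
\<close>

lemma (in cring) total_dominating_set_AG:
  assumes "reduced_ring R"
  shows "total_dominating_set (AG R) (pverts (AG R))"
proof -
  have "\<exists>J\<in>pverts (AG R). (I, J) \<in> parcs (AG R)" if "I \<in> pverts (AG R)" for I
  proof -
    from that have I: "ideal I R" and nz: "I \<noteq> {\<zero>}" "Ann R I \<noteq> {\<zero>}"
      by (auto simp: AG_def annihilating_ideals_def)
    interpret I: ideal I R by (rule I)
    have annI: "ideal (Ann R I) R"
    proof (rule idealI)
      show "ring R" by unfold_locales
      show "subgroup (Ann R I) (add_monoid R)"
        by (rule add.subgroupI)
           (auto simp: Ann_def r_distr r_minus a_inv_def[symmetric] I.Icarr)
    next
      fix a x assume a: "a \<in> Ann R I" and x: "x \<in> carrier R"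
      then have "s \<otimes> (a \<otimes> x) = \<zero>" if "s \<in> I" for s
        using that m_assoc[of s a x] I.Icarr[OF that] by (auto simp: Ann_def)
      then show "a \<otimes> x \<in> Ann R I" "x \<otimes> a \<in> Ann R I"
        using a x by (auto simp: Ann_def m_comm[of x a])
    qed
    have zI: "\<zero> \<in> I" by (rule I.zero_closed)
    have zA: "\<zero> \<in> Ann R I" by (auto simp: Ann_def I.Icarr)
    obtain i where i: "i \<in> I" "i \<noteq> \<zero>" using nz zI by blast
    have "i \<notin> Ann R I"
    proof
      assume "i \<in> Ann R I"
      then have "i [^] (2::nat) = \<zero>" using i by (auto simp: Ann_def numeral_2_eq_2 I.Icarr)
      then show False using assms i I.Icarr unfolding reduced_ring_def by blast
    qed
    with i have ne: "I \<noteq> Ann R I" by blast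
    have "x = \<zero>" if "x \<in> ideal_prod R I (Ann R I)" for x
      using that by induction (auto simp: Ann_def)
    moreover have "\<zero> \<in> ideal_prod R I (Ann R I)"
      using ideal_prod.prod[OF zI zA, of R] by simp
    ultimately have pr: "ideal_prod R I (Ann R I) = {\<zero>}" by blast
    have "i \<in> Ann R (Ann R I)"
      using i by (auto simp: Ann_def I.Icarr m_comm)
    with i annI nz have "Ann R I \<in> annihilating_ideals R"
      by (auto simp: annihilating_ideals_def)
    with that ne pr show ?thesis by (auto simp: AG_def)
  qed
  then show ?thesis by (auto simp: total_dominating_set_def)
qed

end

theory Submission
  imports Defs
begin

text \<open>
  If \<open>Min(R)\<close> is finite, the ideals \<open>\<Inter>(Min(R) - {P})\<close> form a total dominating set: a vertex \<open>I\<close>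
  kills some nonzero \<open>x\<close>, which lies outside some \<open>P\<close> because the minimal primes intersect in \<open>0\<close>,
  hence \<open>I \<subseteq> P\<close>.

  Conversely, a finite dominating set \<open>D\<close> becomes a finite total dominating set \<open>T\<close> after adding the
  annihilators of its members. Every vertex is then contained in \<open>Ann(J)\<close> for some \<open>J \<in> T\<close>. The
  maximal ones among these finitely many annihilators are prime and intersect in \<open>0\<close>, so that every
  minimal prime is one of them (or \<open>0\<close>, when the graph is empty).
\<close>

section \<open>Finite least cardinalities\<close>

text \<open>The minimum is attained, and its cardinal lies below that of every member, so one finite
  member makes it finite.\<close>

lemma cfinite_least_cardinality_iff:
  assumes "F \<noteq> {}"
  shows "BNF_Cardinal_Arithmetic.cfinite (least_cardinality F) \<longleftrightarrow> (\<exists>D\<in>F. finite D)"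
proof
  assume "BNF_Cardinal_Arithmetic.cfinite (least_cardinality F)"
  moreover obtain D where "D \<in> F" "least_cardinality F = card_of D"
    using least_cardinality(1)[OF assms] by blast
  ultimately show "\<exists>D\<in>F. finite D"
    by (auto simp: cfinite_def Field_card_of)
next
  assume "\<exists>D\<in>F. finite D"
  then obtain E where E: "E \<in> F" "finite E" by blast
  obtain D where D: "least_cardinality F = card_of D"
    using least_cardinality(1)[OF assms] by blast
  then have "ordLeq3 (card_of D) (card_of E)"
    using least_cardinality(2)[OF assms] E by auto
  then have "finite D"
    using E card_of_ordLeq_finite by blast
  then show "BNF_Cardinal_Arithmetic.cfinite (least_cardinality F)"
    by (simp add: D cfinite_def Field_card_of card_of_card_order_on)
qed

context cring
begin

section \<open>Annihilators and adjacency\<close>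

lemma ideal_Ann:
  assumes "S \<subseteq> carrier R"
  shows "ideal (Ann R S) R"
proof (rule idealI)
  show "ring R" by unfold_locales
  show "subgroup (Ann R S) (add_monoid R)"
    by (rule add.subgroupI)
       (use assms in \<open>auto simp: Ann_def r_distr r_minus a_inv_def[symmetric] subset_iff\<close>)
next
  fix a x assume a: "a \<in> Ann R S" and x: "x \<in> carrier R"
  then have "s \<otimes> (a \<otimes> x) = \<zero>" if "s \<in> S" for s
    using that m_assoc[of s a x] assms by (auto simp: Ann_def subset_iff)
  then show "a \<otimes> x \<in> Ann R S" "x \<otimes> a \<in> Ann R S"
    using a x by (auto simp: Ann_def m_comm[of x a])
qed

lemma ideal_subset_carrier: "ideal I R \<Longrightarrow> I \<subseteq> carrier R"
  using ideal.Icarr by fastforce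

lemma ideal_neq_zero_iff:
  assumes "ideal I R"
  shows "I \<noteq> {\<zero>} \<longleftrightarrow> (\<exists>i\<in>I. i \<noteq> \<zero>)"
  using assms additive_subgroup.zero_closed[OF ideal.axioms(1)] by blast

text \<open>Vanishing passes from the products to their sums by induction over
  \<open>ideal_prod\<close>.\<close>

lemma ideal_prod_eq_zero_iff:
  assumes "ideal I R" "ideal J R"
  shows "ideal_prod R I J = {\<zero>} \<longleftrightarrow> (\<forall>i\<in>I. \<forall>j\<in>J. i \<otimes> j = \<zero>)"
proof
  assume "ideal_prod R I J = {\<zero>}"
  then show "\<forall>i\<in>I. \<forall>j\<in>J. i \<otimes> j = \<zero>"
    using ideal_prod.prod[of _ I _ J R] by blast
next
  assume zero: "\<forall>i\<in>I. \<forall>j\<in>J. i \<otimes> j = \<zero>"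
  have "x = \<zero>" if "x \<in> ideal_prod R I J" for x
    using that by induction (auto simp: zero)
  moreover have "\<zero> \<in> ideal_prod R I J"
    using ideal_prod.prod[of \<zero> I \<zero> J R] assms[THEN ideal.axioms(1), THEN additive_subgroup.zero_closed]
    by simp
  ultimately show "ideal_prod R I J = {\<zero>}" by blast
qed

lemma reduced_square_zero:
  assumes "reduced_ring R" "x \<in> carrier R" "x \<otimes> x = \<zero>"
  shows "x = \<zero>"
proof -
  have "x [^] (2::nat) = \<zero>"
    using assms by (simp add: numeral_2_eq_2)
  then show ?thesis
    using assms unfolding reduced_ring_def by blast
qed

lemma pverts_AG_iff:
  "I \<in> pverts (AG R) \<longleftrightarrow>
     ideal I R \<and> (\<exists>i\<in>I. i \<noteq> \<zero>) \<and> (\<exists>x\<in>carrier R. x \<noteq> \<zero> \<and> (\<forall>i\<in>I. i \<otimes> x = \<zero>))"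
proof -
  have "Ann R I \<noteq> {\<zero>} \<longleftrightarrow> (\<exists>x\<in>carrier R. x \<noteq> \<zero> \<and> (\<forall>i\<in>I. i \<otimes> x = \<zero>))" if "ideal I R"
    using ideal_neq_zero_iff[OF ideal_Ann[OF ideal_subset_carrier[OF that]]]
    by (auto simp: Ann_def)
  then show ?thesis
    using ideal_neq_zero_iff[of I] by (auto simp: AG_def annihilating_ideals_def)
qed

text \<open>Distinctness follows from the vanishing products: a nonzero \<open>i\<close> in
  \<open>I = J\<close> would satisfy \<open>i \<otimes> i = \<zero>\<close>, against
  reducedness.\<close>

lemma parcs_AG_iff:
  assumes "reduced_ring R"
  shows "(I, J) \<in> parcs (AG R) \<longleftrightarrow>
     I \<in> pverts (AG R) \<and> J \<in> pverts (AG R) \<and> (\<forall>i\<in>I. \<forall>j\<in>J. i \<otimes> j = \<zero>)"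
proof -
  have "I \<noteq> J" if "I \<in> pverts (AG R)" "\<forall>i\<in>I. \<forall>j\<in>J. i \<otimes> j = \<zero>"
    using that reduced_square_zero[OF assms] ideal.Icarr[of I R]
    unfolding pverts_AG_iff by blast
  moreover have "ideal I R" if "I \<in> pverts (AG R)" for I
    using that by (simp add: pverts_AG_iff)
  ultimately show ?thesis
    using ideal_prod_eq_zero_iff[of I J] by (auto simp: AG_def)
qed

text \<open>A nonzero element of \<open>I\<close> kills \<open>Ann R I\<close>, and
  \<open>Ann R I\<close> is nonzero because \<open>I\<close> is a vertex.\<close>

lemma Ann_in_pverts_AG:
  assumes "I \<in> pverts (AG R)"
  shows "Ann R I \<in> pverts (AG R)"
proof -
  have I: "ideal I R" using assms by (simp add: pverts_AG_iff)
  note sub = ideal_subset_carrier[OF I]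
  obtain i where "i \<in> I" "i \<noteq> \<zero>" using assms by (auto simp: pverts_AG_iff)
  moreover have "x \<otimes> i = \<zero>" if "x \<in> Ann R I" "i \<in> I" for x i
    using that sub m_comm[of x i] by (auto simp: Ann_def)
  moreover have "\<exists>x\<in>Ann R I. x \<noteq> \<zero>"
    using assms by (auto simp: pverts_AG_iff Ann_def)
  ultimately show ?thesis
    using ideal_Ann[OF sub] sub unfolding pverts_AG_iff by blast
qed

text \<open>Vertices outside \<open>D\<close> have a neighbour in \<open>D\<close> already, and each
  member of \<open>D\<close> is adjacent to its own annihilator.\<close>

lemma total_dominating_set_insert_Ann:
  assumes red: "reduced_ring R" and D: "dominating_set (AG R) D"
  shows "total_dominating_set (AG R) (D \<union> Ann R ` D)"
proof -
  have sub: "D \<subseteq> pverts (AG R)" using D by (simp add: dominating_set_def)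
  have "(I, Ann R I) \<in> parcs (AG R)" if "I \<in> pverts (AG R)" for I
    using that Ann_in_pverts_AG[OF that] by (auto simp: parcs_AG_iff[OF red] Ann_def)
  then show ?thesis
    using D sub Ann_in_pverts_AG unfolding dominating_set_def total_dominating_set_def by blast
qed

section \<open>Primes over finite intersections, and minimal primes\<close>

text \<open>If no member of \<open>F\<close> lay in \<open>P\<close>, a product of elements outside
  \<open>P\<close>, one from each member, would lie in all of them but not in \<open>P\<close>. For
  empty \<open>F\<close> this is the empty product \<open>\<one>\<close>, which is outside
  \<open>P\<close> since \<open>P\<close> is proper.\<close>

lemma primeideal_superset_of_finite_Inter:
  assumes P: "primeideal P R" and "finite F" and "\<And>I. I \<in> F \<Longrightarrow> ideal I R"
    and Inter: "\<And>x. x \<in> carrier R \<Longrightarrow> (\<And>I. I \<in> F \<Longrightarrow> x \<in> I) \<Longrightarrow> x \<in> P"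
  shows "\<exists>I\<in>F. I \<subseteq> P"
proof (rule ccontr)
  interpret P: primeideal P R by fact
  assume "\<not> (\<exists>I\<in>F. I \<subseteq> P)"
  with assms(2,3) have "\<exists>z\<in>carrier R - P. \<forall>I\<in>F. z \<in> I"
  proof (induction F)
    case empty
    then show ?case
      using P.I_notcarr P.one_imp_carrier by auto
  next
    case (insert J F)
    then obtain z where z: "z \<in> carrier R" "z \<notin> P" "\<forall>I\<in>F. z \<in> I" by auto
    obtain y where y: "y \<in> J" "y \<notin> P" using insert.prems by blast
    have J: "ideal J R" using insert.prems by blast
    have "y \<otimes> z \<in> carrier R" "y \<otimes> z \<notin> P"
      using P.I_prime[of y z] y z ideal.Icarr[OF J] by auto
    moreover have "y \<otimes> z \<in> I" if "I \<in> insert J F" for I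
      using that y z ideal.I_l_closed[of I R z y] ideal.I_r_closed[OF J, of y z]
        ideal.Icarr[OF J] insert.prems by auto
    ultimately show ?case by blast
  qed
  then show False using Inter by blast
qed

text \<open>
  The complement of a maximal multiplicative set \<open>S\<close> containing \<open>x\<close> but not \<open>0\<close> is a minimal prime,
  since in a reduced ring \<open>s a\<^sup>n = 0\<close> implies \<open>s a = 0\<close>, and therefore \<open>a \<notin> S\<close> holds iff \<open>a\<close> is killed
  by an element of \<open>S\<close>.
\<close>

lemma Min_prime_avoiding:
  assumes red: "reduced_ring R" and x: "x \<in> carrier R" "x \<noteq> \<zero>"
  shows "\<exists>P\<in>Min_primes R. x \<notin> P"
proof -
  define mult where "mult S \<longleftrightarrow> S \<subseteq> carrier R \<and> \<one> \<in> S \<and> \<zero> \<notin> S \<and> (\<forall>a\<in>S. \<forall>b\<in>S. a \<otimes> b \<in> S)" for S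
  have nil: "a = \<zero>" if "a \<in> carrier R" "a [^] n = \<zero>" for a and n :: nat
    using that red unfolding reduced_ring_def by blast
  \<comment> \<open>The powers of \<open>x\<close> start the Zorn argument; they avoid
    \<open>\<zero>\<close> because \<open>x\<close> is not nilpotent.\<close>
  have "mult (range (\<lambda>n::nat. x [^] n))"
    unfolding mult_def
  proof (intro conjI ballI)
    show "\<one> \<in> range (\<lambda>n::nat. x [^] n)"
      using rangeI[of "\<lambda>n::nat. x [^] n" 0] by simp
    show "a \<otimes> b \<in> range (\<lambda>n::nat. x [^] n)"
      if "a \<in> range (\<lambda>n::nat. x [^] n)" "b \<in> range (\<lambda>n::nat. x [^] n)" for a b
      using that x by (auto simp: nat_pow_mult)
    show "\<zero> \<notin> range (\<lambda>n::nat. x [^] n)"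
      using nil[OF x(1)] x(2) by (metis imageE)
  qed (use x in auto)
  moreover have "x \<in> range (\<lambda>n::nat. x [^] n)"
    using rangeI[of "\<lambda>n::nat. x [^] n" 1] x by simp
  ultimately have "{S. mult S \<and> x \<in> S} \<noteq> {}" by blast
  moreover have "\<Union>C \<in> {S. mult S \<and> x \<in> S}"
    if C: "C \<noteq> {}" "subset.chain {S. mult S \<and> x \<in> S} C" for C
  proof -
    have sub: "C \<subseteq> {S. mult S \<and> x \<in> S}" and lin: "\<And>A B. A \<in> C \<Longrightarrow> B \<in> C \<Longrightarrow> A \<subseteq> B \<or> B \<subseteq> A"
      using C by (auto simp: subset_chain_def)
    have "a \<otimes> b \<in> \<Union>C" if ab: "A \<in> C" "a \<in> A" "B \<in> C" "b \<in> B" for a b A B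
    proof -
      \<comment> \<open>Of two members of a chain, the larger contains both factors.\<close>
      have "\<exists>E\<in>C. a \<in> E \<and> b \<in> E" using lin[OF ab(1,3)] ab by blast
      then show ?thesis using sub unfolding mult_def by blast
    qed
    then show ?thesis using sub C(1) unfolding mult_def by blast
  qed
  ultimately obtain S where S: "mult S" "x \<in> S"
    and max: "\<And>T. mult T \<Longrightarrow> x \<in> T \<Longrightarrow> S \<subseteq> T \<Longrightarrow> T = S"
    using subset_Zorn_nonempty[of "{S. mult S \<and> x \<in> S}"] by blast
  have Sc: "S \<subseteq> carrier R" and S1: "\<one> \<in> S" and S0: "\<zero> \<notin> S"
    and Sm: "\<And>a b. a \<in> S \<Longrightarrow> b \<in> S \<Longrightarrow> a \<otimes> b \<in> S"
    using S(1) by (auto simp: mult_def)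
  have notin_iff: "a \<notin> S \<longleftrightarrow> (\<exists>s\<in>S. s \<otimes> a = \<zero>)" if a: "a \<in> carrier R" for a
  proof
    assume "\<exists>s\<in>S. s \<otimes> a = \<zero>"
    then show "a \<notin> S" using Sm S0 by metis
  next
    assume "a \<notin> S"
    \<comment> \<open>The multiplicative closure of \<open>S\<close> and \<open>a\<close>: it
      properly contains \<open>S\<close>, so maximality of \<open>S\<close> forces
      \<open>\<zero> \<in> T\<close>.\<close>
    define T where "T = {s \<otimes> a [^] n | s n. s \<in> S \<and> (n::nat) \<in> UNIV}"
    have ST: "S \<subseteq> T"
    proof
      fix s assume "s \<in> S"
      then have "s = s \<otimes> a [^] (0::nat)" using Sc by auto
      then show "s \<in> T" using \<open>s \<in> S\<close> unfolding T_def by blast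
    qed
    have "a = \<one> \<otimes> a [^] (1::nat)" using a by simp
    then have "a \<in> T" using S1 unfolding T_def by blast
    then have "\<not> mult T" using max[of T] ST \<open>a \<notin> S\<close> S(2) by blast
    moreover have "y \<otimes> z \<in> T" if yz: "y \<in> T" "z \<in> T" for y z
    proof -
      obtain s m t n where st: "s \<in> S" "t \<in> S" "y = s \<otimes> a [^] (m::nat)" "z = t \<otimes> a [^] (n::nat)"
        using yz unfolding T_def by blast
      have "s \<in> carrier R" "t \<in> carrier R" using st Sc by auto
      then have "y \<otimes> z = (s \<otimes> t) \<otimes> a [^] (m + n)"
        using a by (simp add: st nat_pow_mult[symmetric] m_ac)
      then show ?thesis using Sm[OF st(1,2)] unfolding T_def by blast
    qed
    moreover have "T \<subseteq> carrier R" using Sc a by (auto simp: T_def)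
    ultimately have "\<zero> \<in> T" using ST S1 unfolding mult_def by blast
    then obtain s n where s: "s \<in> S" "\<zero> = s \<otimes> a [^] (n::nat)"
      unfolding T_def by blast
    have sc: "s \<in> carrier R" using s Sc by blast
    \<comment> \<open>The exponent \<open>Suc n\<close> makes \<open>s \<otimes> a [^] n\<close> a
      factor even when \<open>n = 0\<close>.\<close>
    have "(s \<otimes> a) [^] Suc n = (s \<otimes> a [^] n) \<otimes> (s [^] n \<otimes> a)"
      using sc a by (simp add: nat_pow_distrib m_ac)
    also have "\<dots> = \<zero>" using s(2)[symmetric] sc a by simp
    finally show "\<exists>s\<in>S. s \<otimes> a = \<zero>" using nil[of "s \<otimes> a"] s(1) sc a by blast
  qed
  define P where "P = carrier R - S"
  \<comment> \<open>In this form \<open>P\<close> is the kernel of the localization at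
    \<open>S\<close>, from which its closure properties follow.\<close>
  have P_iff: "a \<in> P \<longleftrightarrow> a \<in> carrier R \<and> (\<exists>s\<in>S. s \<otimes> a = \<zero>)" for a
    using notin_iff unfolding P_def by blast
  have Pm: "y \<otimes> a \<in> P" if ay: "a \<in> P" "y \<in> carrier R" for a y
  proof -
    obtain s where s: "s \<in> S" "s \<otimes> a = \<zero>" using ay P_iff by blast
    have c: "s \<in> carrier R" "a \<in> carrier R" using s Sc ay P_iff by auto
    have "s \<otimes> (y \<otimes> a) = y \<otimes> (s \<otimes> a)" using c that by (simp add: m_lcomm)
    then show ?thesis using s c that by (auto simp: P_iff)
  qed
  have Pa: "a \<oplus> b \<in> P" if ab: "a \<in> P" "b \<in> P" for a b
  proof -
    obtain s t where st: "s \<in> S" "s \<otimes> a = \<zero>" "t \<in> S" "t \<otimes> b = \<zero>"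
      using ab P_iff by blast
    have c: "s \<in> carrier R" "t \<in> carrier R" "a \<in> carrier R" "b \<in> carrier R"
      using st Sc ab P_iff by auto
    have "(s \<otimes> t) \<otimes> (a \<oplus> b) = t \<otimes> (s \<otimes> a) \<oplus> s \<otimes> (t \<otimes> b)"
      using c by (simp add: r_distr m_ac)
    then have "(s \<otimes> t) \<otimes> (a \<oplus> b) = \<zero>" using c st by simp
    then show ?thesis using Sm[OF st(1,3)] c P_iff by blast
  qed
  have "ideal P R"
  proof (rule idealI)
    show "ring R" by unfold_locales
    show "subgroup P (add_monoid R)"
    proof (rule add.subgroupI)
      show "P \<subseteq> carrier R" by (auto simp: P_def)
      show "P \<noteq> {}" using S0 by (auto simp: P_def)
      show "\<ominus> a \<in> P" if "a \<in> P" for a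
        using Pm[OF that, of "\<ominus> \<one>"] that P_iff[of a] by (simp add: l_minus)
    qed (use Pa in auto)
  next
    fix a y assume "a \<in> P" "y \<in> carrier R"
    then show "y \<otimes> a \<in> P" "a \<otimes> y \<in> P"
      using Pm[of a y] P_iff[of a] m_comm[of a y] by auto
  qed
  then have "primeideal P R"
    by (rule primeidealI) (use S1 Sm in \<open>auto simp: P_def intro: is_cring\<close>)
  moreover have "Q = P" if Q: "primeideal Q R" "Q \<subseteq> P" for Q
  proof -
    interpret Q: primeideal Q R by fact
    \<comment> \<open>The witness \<open>s\<close> avoids \<open>Q\<close>, since \<open>Q\<close>
      is contained in the complement of \<open>S\<close>; primality then puts \<open>a\<close> into
      \<open>Q\<close>.\<close>
    have "a \<in> Q" if a: "a \<in> P" for a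
    proof -
      obtain s where s: "s \<in> S" "s \<otimes> a = \<zero>" using a P_iff by blast
      then have "s \<notin> Q" using Q(2) by (auto simp: P_def)
      then show ?thesis
        using Q.I_prime[of s a] s Sc that by (auto simp: P_def)
    qed
    then show ?thesis using Q(2) by blast
  qed
  ultimately show ?thesis using S(2) unfolding Min_primes_def P_def by blast
qed

section \<open>From finitely many minimal primes to a finite total dominating set\<close>

lemma finite_total_dominating_set_if_finite_Min_primes:
  assumes red: "reduced_ring R" and fin: "finite (Min_primes R)"
  shows "\<exists>S. total_dominating_set (AG R) S \<and> finite S"
proof -
  \<comment> \<open>Intersecting inside \<open>carrier R\<close> makes \<open>Q P\<close> the whole
    ring, not \<open>UNIV\<close>, when \<open>P\<close> is the only minimal prime.\<close>
  define Q where "Q P = {x \<in> carrier R. \<forall>P'\<in>Min_primes R - {P}. x \<in> P'}" for P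
  have prime: "primeideal P R" if "P \<in> Min_primes R" for P
    using that by (simp add: Min_primes_def)
  then have ideal: "ideal P R" if "P \<in> Min_primes R" for P
    using that primeideal.axioms(1) by blast
  have id_Q: "ideal (Q P) R" for P
  proof -
    have "Q P = \<Inter> (insert (carrier R) (Min_primes R - {P}))" by (auto simp: Q_def)
    moreover have "ideal (\<Inter> (insert (carrier R) (Min_primes R - {P}))) R"
      by (rule i_Intersect) (use ideal oneideal in auto)
    ultimately show ?thesis by simp
  qed
  have neighbour: "\<exists>P\<in>Min_primes R. (I, Q P) \<in> parcs (AG R)" if I: "I \<in> pverts (AG R)" for I
  proof -
    obtain x where x: "x \<in> carrier R" "x \<noteq> \<zero>" "\<And>i. i \<in> I \<Longrightarrow> i \<otimes> x = \<zero>"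
      using I by (auto simp: pverts_AG_iff)
    obtain P where P: "P \<in> Min_primes R" "x \<notin> P"
      using Min_prime_avoiding[OF red x(1,2)] by blast
    interpret P: primeideal P R by (rule prime[OF P(1)])
    have idI: "ideal I R" using I by (simp add: pverts_AG_iff)
    note I_carr = ideal.Icarr[OF idI]
    have IP: "i \<in> P" if "i \<in> I" for i
      using P.I_prime[of i x] that x P(2) I_carr by auto
    \<comment> \<open>The product lies in \<open>P\<close> through \<open>i\<close> and in every
      other minimal prime through \<open>q\<close>, hence vanishes.\<close>
    have zero: "i \<otimes> q = \<zero>" if iq: "i \<in> I" "q \<in> Q P" for i q
    proof (rule ccontr)
      assume "i \<otimes> q \<noteq> \<zero>"
      moreover have qc: "q \<in> carrier R" using iq by (simp add: Q_def)
      ultimately obtain P' where P': "P' \<in> Min_primes R" "i \<otimes> q \<notin> P'"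
        using Min_prime_avoiding[OF red, of "i \<otimes> q"] I_carr[OF iq(1)] by auto
      then show False
      proof (cases "P' = P")
        case True
        then show False using P' P.I_r_closed IP[OF iq(1)] qc by blast
      next
        case False
        then have "q \<in> P'" using iq P' by (simp add: Q_def)
        then show False
          using ideal.I_l_closed[OF ideal[OF P'(1)]] I_carr[OF iq(1)] P'(2) by blast
      qed
    qed
    \<comment> \<open>Otherwise the intersection of the other minimal primes is zero and so lies in
      \<open>P\<close>; by finiteness one of them lies in \<open>P\<close>, against
      minimality.\<close>
    have "\<exists>q\<in>Q P. q \<noteq> \<zero>"
    proof (rule ccontr)
      assume no: "\<not> (\<exists>q\<in>Q P. q \<noteq> \<zero>)"
      have "\<exists>P'\<in>Min_primes R - {P}. P' \<subseteq> P"
      proof (rule primeideal_superset_of_finite_Inter)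
        show "y \<in> P" if "y \<in> carrier R" "\<And>P'. P' \<in> Min_primes R - {P} \<Longrightarrow> y \<in> P'" for y
        proof -
          have "y \<in> Q P" using that by (simp add: Q_def)
          then show ?thesis using no P.zero_closed by metis
        qed
      qed (use fin ideal P.primeideal_axioms in auto)
      then show False using P(1) prime unfolding Min_primes_def by blast
    qed
    moreover obtain i where i: "i \<in> I" "i \<noteq> \<zero>" using I by (auto simp: pverts_AG_iff)
    moreover have "q \<otimes> i = \<zero>" if "q \<in> Q P" for q
      using zero[OF i(1) that] m_comm[of q i] I_carr[OF i(1)] that by (simp add: Q_def)
    ultimately have "Q P \<in> pverts (AG R)"
      using id_Q I_carr unfolding pverts_AG_iff by blast
    then show ?thesis
      using P(1) I zero parcs_AG_iff[OF red] by blast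
  qed
  \<comment> \<open>Some \<open>Q P\<close> may fail to be vertices, as over a field, where
    \<open>Q {\<zero>}\<close> is the whole ring; these are discarded.\<close>
  have "total_dominating_set (AG R) (Q ` Min_primes R \<inter> pverts (AG R))"
    unfolding total_dominating_set_def
  proof (intro conjI ballI)
    fix I assume "I \<in> pverts (AG R)"
    then obtain P where "P \<in> Min_primes R" "(I, Q P) \<in> parcs (AG R)"
      using neighbour by blast
    then show "\<exists>J\<in>Q ` Min_primes R \<inter> pverts (AG R). (I, J) \<in> parcs (AG R)"
      by (intro bexI[of _ "Q P"]) (auto simp: parcs_AG_iff[OF red])
  qed auto
  then show ?thesis using fin by blast
qed

section \<open>From a finite total dominating set to finitely many minimal primes\<close>

lemma finite_Min_primes_if_finite_total_dominating_set:
  assumes red: "reduced_ring R" and T: "total_dominating_set (AG R) T" "finite T"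
  shows "finite (Min_primes R)"
proof -
  define M where "M = {A \<in> Ann R ` T. \<forall>B\<in>Ann R ` T. A \<subseteq> B \<longrightarrow> A = B}"
  have T_vert: "J \<in> pverts (AG R)" if "J \<in> T" for J
    using that T(1) by (auto simp: total_dominating_set_def)
  have idJ: "ideal J R" if "J \<in> T" for J
    using T_vert[OF that] by (simp add: pverts_AG_iff)
  have J_carr: "J \<subseteq> carrier R" if "J \<in> T" for J
    using ideal_subset_carrier[OF idJ[OF that]] .
  have M_sub: "M \<subseteq> Ann R ` T" by (auto simp: M_def)
  have finM: "finite M" using M_sub T(2) finite_surj by blast
  have cover: "\<exists>A\<in>M. I \<subseteq> A" if I: "I \<in> pverts (AG R)" for I
  proof -
    obtain J where J: "J \<in> T" "(I, J) \<in> parcs (AG R)"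
      using I T(1) by (auto simp: total_dominating_set_def)
    have "I \<subseteq> Ann R J"
    proof
      fix i assume i: "i \<in> I"
      have ic: "i \<in> carrier R" using i I ideal.Icarr by (fastforce simp: pverts_AG_iff)
      have "j \<otimes> i = \<zero>" if "j \<in> J" for j
        using J i ic that J_carr[OF J(1)] m_comm[of j i] by (auto simp: parcs_AG_iff[OF red])
      then show "i \<in> Ann R J" using ic by (simp add: Ann_def)
    qed
    moreover obtain A where "A \<in> Ann R ` T" "Ann R J \<subseteq> A" "\<forall>B\<in>Ann R ` T. A \<subseteq> B \<longrightarrow> A = B"
      using finite_has_maximal2[of "Ann R ` T" "Ann R J"] T(2) J(1)
      by (metis finite_imageI imageI)
    ultimately show ?thesis unfolding M_def by blast
  qed
  \<comment> \<open>Source of the vertices fed to \<open>cover\<close> below: \<open>s\<close>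
    witnesses that \<open>Ann R S\<close> has a nonzero annihilator, \<open>y\<close> that it is
    nonzero itself.\<close>
  have Ann_vert: "Ann R S \<in> pverts (AG R)"
    if "S \<subseteq> carrier R" "s \<in> S" "s \<noteq> \<zero>" "y \<in> Ann R S" "y \<noteq> \<zero>" for S s y
  proof -
    have "s \<in> carrier R" using that by blast
    moreover have "z \<otimes> s = \<zero>" if "z \<in> Ann R S" for z
      using that \<open>s \<in> S\<close> m_comm[of z s] calculation by (simp add: Ann_def)
    ultimately show ?thesis
      using that ideal_Ann[of S] unfolding pverts_AG_iff by blast
  qed
  have idM: "ideal A R" if "A \<in> M" for A
    using that M_sub ideal_Ann J_carr by blast
  have primeM: "primeideal A R" if A: "A \<in> M" for A
  proof (rule primeidealI[OF idM[OF A] is_cring])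
    obtain J where J: "J \<in> T" "A = Ann R J" using A M_sub by blast
    note Jc = J_carr[OF J(1)]
    show "carrier R \<noteq> A"
    proof
      assume "carrier R = A"
      then have "\<one> \<in> Ann R J" using J by auto
      then show False
        using T_vert[OF J(1)] Jc by (auto simp: Ann_def pverts_AG_iff subset_iff)
    qed
    fix x y assume xy: "x \<in> carrier R" "y \<in> carrier R" "x \<otimes> y \<in> A"
    have "x \<in> A" if y: "y \<notin> A"
    proof -
      \<comment> \<open>\<open>Ann R yJ\<close> contains \<open>A\<close> and is a vertex because
        \<open>y \<notin> A\<close>, so \<open>cover\<close> places it below some \<open>B\<close>
        in \<open>M\<close>. Maximality of \<open>A\<close> gives \<open>A = B = Ann R yJ\<close>,
        which contains \<open>x\<close> because \<open>x \<otimes> y\<close> kills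
        \<open>J\<close>.\<close>
      define yJ where "yJ = (\<lambda>j. j \<otimes> y) ` J"
      obtain j where j: "j \<in> J" "j \<otimes> y \<noteq> \<zero>" using y J xy by (auto simp: Ann_def)
      have A_sub: "A \<subseteq> Ann R yJ"
      proof
        fix a assume a: "a \<in> A"
        then have ac: "a \<in> carrier R" "\<And>j. j \<in> J \<Longrightarrow> j \<otimes> a = \<zero>" using J by (auto simp: Ann_def)
        have "j \<otimes> y \<otimes> a = \<zero>" if "j \<in> J" for j
        proof -
          have "j \<otimes> y \<otimes> a = y \<otimes> (j \<otimes> a)" using ac(1) that Jc xy by (auto simp: m_ac subset_iff)
          then show ?thesis using ac(2)[OF that] xy by simp
        qed
        then show "a \<in> Ann R yJ" using ac by (auto simp: Ann_def yJ_def)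
      qed
      \<comment> \<open>A nonzero element of \<open>Ann R yJ\<close> is taken from \<open>A\<close>,
        which is the annihilator of a vertex and hence a vertex.\<close>
      obtain a where "a \<in> A" "a \<noteq> \<zero>"
        using Ann_in_pverts_AG[OF T_vert[OF J(1)]] J(2) by (auto simp: pverts_AG_iff)
      then have "Ann R yJ \<in> pverts (AG R)"
        using A_sub j Jc xy by (intro Ann_vert[of yJ "j \<otimes> y" a]) (auto simp: yJ_def)
      then obtain B where B: "B \<in> M" "Ann R yJ \<subseteq> B" using cover by blast
      then have "A \<subseteq> B" "B \<in> Ann R ` T" using A_sub M_sub by auto
      then have "A = B" using A by (auto simp: M_def)
      then have "Ann R yJ \<subseteq> A" using B by simp
      moreover have "j \<otimes> y \<otimes> x = \<zero>" if "j \<in> J" for j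
      proof -
        have "j \<otimes> (x \<otimes> y) = \<zero>" using xy(3) that J by (auto simp: Ann_def)
        then show ?thesis using that Jc xy by (auto simp: m_ac subset_iff)
      qed
      then have "x \<in> Ann R yJ" using xy by (auto simp: Ann_def yJ_def)
      ultimately show ?thesis by blast
    qed
    then show "x \<in> A \<or> y \<in> A" by blast
  qed
  have Inter_zero: "z = \<zero>" if ne: "M \<noteq> {}" and z: "z \<in> carrier R" "\<And>A. A \<in> M \<Longrightarrow> z \<in> A" for z
  proof (rule ccontr)
    assume "z \<noteq> \<zero>"
    \<comment> \<open>\<open>Ann R {z}\<close> contains every \<open>J\<close> in \<open>T\<close>
      with \<open>Ann R J\<close> in \<open>M\<close>. Once it lies in some \<open>Ann R K\<close>
      of \<open>M\<close>, then \<open>K \<subseteq> Ann R {z} \<subseteq> Ann R K\<close>, so the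
      elements of \<open>K\<close> square to zero.\<close>
    have kill: "j \<in> Ann R {z}" if "J \<in> T" "Ann R J \<in> M" "j \<in> J" for J j
      using that z(2)[OF that(2)] z(1) J_carr[OF that(1)] m_comm[of z j] by (auto simp: Ann_def)
    obtain J where J: "J \<in> T" "Ann R J \<in> M" using ne M_sub by blast
    then obtain j where "j \<in> J" "j \<noteq> \<zero>" using T_vert by (auto simp: pverts_AG_iff)
    then have "Ann R {z} \<in> pverts (AG R)"
      using kill[OF J] z \<open>z \<noteq> \<zero>\<close> by (intro Ann_vert[of "{z}" z j]) auto
    then obtain A where A: "A \<in> M" "Ann R {z} \<subseteq> A" using cover by blast
    then obtain K where K: "K \<in> T" "A = Ann R K" using M_sub by blast
    obtain k where k: "k \<in> K" "k \<noteq> \<zero>" using T_vert[OF K(1)] by (auto simp: pverts_AG_iff)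
    have "k \<in> Ann R K" using kill[of K k] A K k by blast
    then have "k \<otimes> k = \<zero>" using k by (auto simp: Ann_def)
    then show False using reduced_square_zero[OF red, of k] k J_carr[OF K(1)] by blast
  qed
  have "Min_primes R \<subseteq> insert {\<zero>} M"
  proof
    fix P assume P: "P \<in> Min_primes R"
    then have prime: "primeideal P R" by (simp add: Min_primes_def)
    interpret P: primeideal P R by (rule prime)
    show "P \<in> insert {\<zero>} M"
    proof (cases "M = {}")
      case True
      \<comment> \<open>With \<open>M\<close> empty, \<open>cover\<close> leaves no vertices, while
        a zero divisor would provide one; the proper ideal \<open>P\<close> shows that the ring is
        nonzero. So \<open>R\<close> is a domain.\<close>
      have "primeideal {\<zero>} R"
      proof (rule primeidealI[OF zeroideal is_cring])
        show "carrier R \<noteq> {\<zero>}"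
          using P.I_notcarr P.zero_closed ideal_subset_carrier[OF P.is_ideal] by auto
        fix a b assume ab: "a \<in> carrier R" "b \<in> carrier R" "a \<otimes> b \<in> {\<zero>}"
        show "a \<in> {\<zero>} \<or> b \<in> {\<zero>}"
        proof (rule ccontr)
          assume "\<not> (a \<in> {\<zero>} \<or> b \<in> {\<zero>})"
          then have "Ann R {a} \<in> pverts (AG R)"
            using ab by (intro Ann_vert[of "{a}" a b]) (auto simp: Ann_def)
          then show False using cover True by blast
        qed
      qed
      moreover have "{\<zero>} \<subseteq> P" using P.zero_closed by blast
      ultimately show ?thesis using P by (auto simp: Min_primes_def)
    next
      case False
      \<comment> \<open>The intersection of \<open>M\<close> is zero, hence inside \<open>P\<close>,
        so some prime in \<open>M\<close> lies below \<open>P\<close> and equals it by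
        minimality.\<close>
      have "\<exists>A\<in>M. A \<subseteq> P"
      proof (rule primeideal_superset_of_finite_Inter[OF prime finM idM])
        show "z \<in> P" if "z \<in> carrier R" "\<And>A. A \<in> M \<Longrightarrow> z \<in> A" for z
          using Inter_zero[OF False that] P.zero_closed by simp
      qed
      then obtain A where A: "A \<in> M" "A \<subseteq> P" by blast
      then have "A = P" using P primeM[OF A(1)] by (simp add: Min_primes_def)
      then show ?thesis using A(1) by simp
    qed
  qed
  then show ?thesis using finM finite_subset by blast
qed

end

section \<open>Equivalence of the three finiteness conditions\<close>

theorem corollary4p7:
  fixes R :: "('a, 'b) ring_scheme"
  assumes "cring R" and "reduced_ring R"
  shows "(BNF_Cardinal_Arithmetic.cfinite (dt (AG R)) \<longleftrightarrow> BNF_Cardinal_Arithmetic.cfinite (dt_t (AG R))) \<and>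
         (BNF_Cardinal_Arithmetic.cfinite (dt_t (AG R)) \<longleftrightarrow> finite (Min_primes R))"
proof -
  interpret cring R by fact
  let ?G = "AG R"
  have total_imp: "dominating_set ?G S" if "total_dominating_set ?G S" for S
    using that by (auto simp: total_dominating_set_def dominating_set_def)
  \<comment> \<open>The whole vertex set belongs to both families, so each minimum is taken over a
    nonempty family and is finite exactly when some member is.\<close>
  have total: "total_dominating_set ?G (pverts ?G)"
    by (rule total_dominating_set_AG) fact
  have dt_iff: "BNF_Cardinal_Arithmetic.cfinite (dt ?G) \<longleftrightarrow> (\<exists>D. dominating_set ?G D \<and> finite D)"
    unfolding dt_def by (subst cfinite_least_cardinality_iff) (use total total_imp in auto)
  have dt_t_iff: "BNF_Cardinal_Arithmetic.cfinite (dt_t ?G) \<longleftrightarrow> (\<exists>S. total_dominating_set ?G S \<and> finite S)"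
    unfolding dt_t_def by (subst cfinite_least_cardinality_iff) (use total in auto)
  have "\<exists>S. total_dominating_set ?G S \<and> finite S" if "dominating_set ?G D" "finite D" for D
    using total_dominating_set_insert_Ann[OF assms(2) that(1)] that(2) by blast
  then show ?thesis
    unfolding dt_iff dt_t_iff
    using total_imp finite_total_dominating_set_if_finite_Min_primes[OF assms(2)]
      finite_Min_primes_if_finite_total_dominating_set[OF assms(2)] by blast
qed

end
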